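(* If $L$ is a finite distributive lattice, then $D(L)\le 2$, and $D(L)=2$ if and only if $D(Q_L)>1$.
   Context: A point of a lattice is join-irreducible if in the Hasse diagram it has exactly one downward edge; $Q_L$ is the subposet induced by the join-irreducible points of $L$. A coloring of a poset is distinguishing if the only color-preserving automorphism is the identity; $D(P)$ is the least number of colors in a distinguishing coloring of $P$. *)

theory Defs
  imports Main
begin

text \<open>A poset is given by a set \<open>P\<close> over a type of class \<^class>\<open>order\<close>, with the induced order.\<close>

definition poset_automorphism :: "'a::order set \<Rightarrow> ('a \<Rightarrow> 'a) \<Rightarrow> bool" where
  "poset_automorphism P f \<longleftrightarrow>
     bij_betw f P P \<and> (\<forall>x\<in>P. \<forall>y\<in>P. x \<le> y \<longleftrightarrow> f x \<le> f y)"

definition distinguishing :: "'a::order set \<Rightarrow> ('a \<Rightarrow> 'c) \<Rightarrow> bool" where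
  "distinguishing P c \<longleftrightarrow>
     (\<forall>f. poset_automorphism P f \<and> (\<forall>x\<in>P. c (f x) = c x) \<longrightarrow> (\<forall>x\<in>P. f x = x))"

text \<open>
  Meaningful for finite \<open>P\<close>, where the least number exists by
  \<open>ex_distinguishing_coloring\<close> below; it is \<open>0\<close> for the empty poset.
\<close>

definition distinguishing_number :: "'a::order set \<Rightarrow> nat" where
  "distinguishing_number P =
     (LEAST k. \<exists>c :: 'a \<Rightarrow> nat. c ` P \<subseteq> {..<k} \<and> distinguishing P c)"

lemma ex_distinguishing_coloring:
  assumes "finite P"
  shows "\<exists>k. \<exists>c :: 'a::order \<Rightarrow> nat. c ` P \<subseteq> {..<k} \<and> distinguishing P c"
proof -
  obtain c :: "'a \<Rightarrow> nat" and n where c: "c ` P = {i. i < n}" "inj_on c P"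
    using finite_imp_inj_to_nat_seg[OF assms] by blast
  have "distinguishing P c"
    unfolding distinguishing_def poset_automorphism_def
    using c(2) by (metis bij_betwE inj_on_eq_iff)
  then show ?thesis
    using c(1) by auto
qed

definition covered_by :: "'a::order \<Rightarrow> 'a \<Rightarrow> bool" where
  "covered_by x y \<longleftrightarrow> x < y \<and> \<not> (\<exists>z. x < z \<and> z < y)"

definition join_irreducible :: "'a::lattice \<Rightarrow> bool" where
  "join_irreducible y \<longleftrightarrow> (\<exists>!x. covered_by x y)"

end

theory Submission
  imports Defs
begin

text \<open>
  Colour one maximal chain against the rest of \<open>L\<close>.  A colour-preserving automorphism maps the
  chain to itself, hence fixes it pointwise, and then it is the identity: climbing the chain, if
  \<open>c\<close> covers \<open>d\<close> in the chain and everything below \<open>d\<close> is fixed, then for \<open>x \<le> c\<close> both the meet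
  \<open>x \<sqinter> d\<close> and the join \<open>x \<squnion> d \<in> {d, c}\<close> are fixed, and in a distributive lattice they determine
  \<open>x\<close>.  For the second claim, \<open>D(P) \<le> 1\<close> says that \<open>P\<close> is rigid, and by Birkhoff's representation
  of \<open>L\<close> by the down-sets of \<open>Q\<^sub>L\<close>, the lattice \<open>L\<close> is rigid if and only if \<open>Q\<^sub>L\<close> is.
\<close>

section \<open>Rigidity and distinguishing numbers at most 1\<close>

definition rigid :: "'a::order set \<Rightarrow> bool" where
  "rigid P \<longleftrightarrow> (\<forall>f. poset_automorphism P f \<longrightarrow> (\<forall>x\<in>P. f x = x))"

lemma distinguishing_number_le:
  fixes c :: "'a::order \<Rightarrow> nat"
  assumes "c ` P \<subseteq> {..<k}" and "distinguishing P c"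
  shows "distinguishing_number P \<le> k"
  unfolding distinguishing_number_def by (rule Least_le) (use assms in blast)

lemma distinguishing_number_attained:
  fixes P :: "'a::order set"
  assumes "finite P"
  obtains c :: "'a \<Rightarrow> nat" where "c ` P \<subseteq> {..<distinguishing_number P}" "distinguishing P c"
  using LeastI_ex[OF ex_distinguishing_coloring[OF assms]]
  unfolding distinguishing_number_def by blast

text \<open>With at most one colour every point is coloured 0, so preserving colours is no
  restriction. The bound \<open>\<le> 1\<close> also covers the empty poset, whose number is 0; this
  occurs for the join-irreducibles of a one-point lattice.\<close>

lemma distinguishing_number_le_1_iff:
  assumes "finite (P :: 'a::order set)"
  shows "distinguishing_number P \<le> 1 \<longleftrightarrow> rigid P"
proof
  assume le: "distinguishing_number P \<le> 1"
  obtain c :: "'a \<Rightarrow> nat" where c: "c ` P \<subseteq> {..<distinguishing_number P}" "distinguishing P c"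
    using distinguishing_number_attained[OF assms] .
  have "c x = 0" if "x \<in> P" for x
    using c(1) le that by fastforce
  then have "c (f x) = c x" if "poset_automorphism P f" "x \<in> P" for f x
    using that by (metis bij_betwE poset_automorphism_def)
  then show "rigid P"
    using c(2) unfolding rigid_def distinguishing_def by blast
next
  assume "rigid P"
  then have "distinguishing P (\<lambda>_. 0 :: nat)"
    unfolding rigid_def distinguishing_def by blast
  then show "distinguishing_number P \<le> 1"
    by (intro distinguishing_number_le[of "\<lambda>_. 0"]) auto
qed

section \<open>Automorphisms of orders and lattices\<close>

lemma automorphism_UNIV_iff:
  "poset_automorphism (UNIV :: 'a::order set) f \<longleftrightarrow> bij f \<and> (\<forall>x y. x \<le> y \<longleftrightarrow> f x \<le> f y)"
  by (simp add: poset_automorphism_def)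

lemma automorphism_less_iff:
  assumes "poset_automorphism (UNIV :: 'a::order set) f"
  shows "f x < f y \<longleftrightarrow> x < y"
  using assms by (auto simp: automorphism_UNIV_iff less_le_not_le)

lemma automorphism_sup:
  assumes "poset_automorphism (UNIV :: 'a::lattice set) f"
  shows "f (sup x y) = sup (f x) (f y)"
proof (rule antisym)
  \<comment> \<open>Pulled back along \<open>f\<close>, the join of the images becomes an upper
    bound \<open>z\<close> of \<open>x\<close> and \<open>y\<close>.\<close>
  obtain z where z: "sup (f x) (f y) = f z"
    using assms by (metis automorphism_UNIV_iff bij_pointE)
  then have "x \<le> z" "y \<le> z"
    using assms by (metis automorphism_UNIV_iff sup.cobounded1 sup.cobounded2)+
  then show "f (sup x y) \<le> sup (f x) (f y)"
    using assms z by (metis automorphism_UNIV_iff sup.bounded_iff)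
  show "sup (f x) (f y) \<le> f (sup x y)"
    using assms by (simp add: automorphism_UNIV_iff)
qed

lemma automorphism_inf:
  assumes "poset_automorphism (UNIV :: 'a::lattice set) f"
  shows "f (inf x y) = inf (f x) (f y)"
proof (rule antisym)
  obtain z where z: "inf (f x) (f y) = f z"
    using assms by (metis automorphism_UNIV_iff bij_pointE)
  then have "z \<le> x" "z \<le> y"
    using assms by (metis automorphism_UNIV_iff inf.cobounded1 inf.cobounded2)+
  then show "inf (f x) (f y) \<le> f (inf x y)"
    using assms z by (metis automorphism_UNIV_iff inf.bounded_iff)
  show "f (inf x y) \<le> inf (f x) (f y)"
    using assms by (simp add: automorphism_UNIV_iff)
qed

text \<open>An automorphism maps the down-set of \<open>x\<close> bijectively onto that of
  \<open>f x\<close>. Comparability nests these two finite sets of equal size, so they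
  coincide.\<close>

lemma automorphism_fixes_if_comparable:
  assumes f: "poset_automorphism (UNIV :: 'a::{finite, order} set) f"
    and "x \<le> f x \<or> f x \<le> x"
  shows "f x = x"
proof -
  have "{..f x} \<subseteq> f ` {..x}"
  proof
    fix y assume "y \<in> {..f x}"
    moreover obtain z where "y = f z"
      using f by (metis automorphism_UNIV_iff bij_pointE)
    ultimately show "y \<in> f ` {..x}"
      using f by (simp add: automorphism_UNIV_iff)
  qed
  moreover have "f ` {..x} \<subseteq> {..f x}"
    using f by (auto simp: automorphism_UNIV_iff)
  ultimately have "f ` {..x} = {..f x}"
    by blast
  moreover have "inj_on f {..x}"
    using f by (meson automorphism_UNIV_iff bij_is_inj inj_on_subset subset_UNIV)
  ultimately have "card {..f x} = card {..x}"
    by (metis card_image)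
  with assms(2) have "{..f x} = {..x}"
    by (metis atMost_subset_iff card_subset_eq finite)
  then show ?thesis
    by simp
qed

section \<open>Two colours suffice: a maximal chain\<close>

lemma distrib_lattice_cancel:
  fixes x y d :: "'a::distrib_lattice"
  assumes "inf x d = inf y d" and "sup x d = sup y d"
  shows "x = y"
  by (metis assms inf_commute inf_sup_absorb inf_sup_distrib1)

lemma obtain_maximal_chain:
  obtains C :: "'a::{finite, order} set"
  where "\<And>x y. x \<in> C \<Longrightarrow> y \<in> C \<Longrightarrow> x \<le> y \<or> y \<le> x"
    and "\<And>z. (\<And>x. x \<in> C \<Longrightarrow> x \<le> z \<or> z \<le> x) \<Longrightarrow> z \<in> C"
proof -
  define chains where "chains = {C :: 'a set. \<forall>x\<in>C. \<forall>y\<in>C. x \<le> y \<or> y \<le> x}"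
  have "{} \<in> chains"
    by (simp add: chains_def)
  then obtain C where C: "C \<in> chains" "\<And>D. D \<in> chains \<Longrightarrow> C \<subseteq> D \<Longrightarrow> C = D"
    using finite_has_maximal[of chains] by auto
  have "z \<in> C" if "\<And>x. x \<in> C \<Longrightarrow> x \<le> z \<or> z \<le> x" for z
  proof -
    have "insert z C \<in> chains"
      using C(1) that by (auto simp: chains_def)
    then show ?thesis
      using C(2) by blast
  qed
  with C(1) show thesis
    by (intro that[of C]) (auto simp: chains_def)
qed

lemma automorphism_fixing_maximal_chain:
  fixes C :: "'a::{finite, distrib_lattice} set"
  assumes f: "poset_automorphism UNIV f"
    and chain: "\<And>x y. x \<in> C \<Longrightarrow> y \<in> C \<Longrightarrow> x \<le> y \<or> y \<le> x"
    and maximal: "\<And>z. (\<And>x. x \<in> C \<Longrightarrow> x \<le> z \<or> z \<le> x) \<Longrightarrow> z \<in> C"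
    and fixed: "\<And>x. x \<in> C \<Longrightarrow> f x = x"
  shows "f x = x"
proof -
  \<comment> \<open>The claim concerns all points below \<open>c\<close>, on the chain or off it;
    the induction moves up the chain.\<close>
  have below: "c \<in> C \<Longrightarrow> x \<le> c \<Longrightarrow> f x = x" for c x
  proof (induction "card {..<c}" arbitrary: c x rule: less_induct)
    case less
    show ?case
    proof (cases "\<exists>d\<in>C. d < c")
      case False
      \<comment> \<open>Here \<open>c\<close> is the least point of the chain, so any
        \<open>x\<close> below it is comparable with the whole chain.\<close>
      then have "c \<le> y" if "y \<in> C" for y
        using chain that less.prems(1) by (metis order.order_iff_strict)
      then have "x \<in> C"
        using less.prems(2) by (intro maximal) (meson order_trans)
      then show ?thesis
        by (rule fixed)
    next
      case True
      then obtain d where d: "d \<in> C" "d < c" and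
        dmax: "\<And>e. e \<in> C \<Longrightarrow> e < c \<Longrightarrow> d \<le> e \<Longrightarrow> d = e"
        using finite_has_maximal[of "{d \<in> C. d < c}"] by auto
      have "card {..<d} < card {..<c}"
        using d(2) by (intro psubset_card_mono) auto
      then have below_d: "f y = y" if "y \<le> d" for y
        using less.hyps d(1) that by blast
      \<comment> \<open>No chain point lies strictly between \<open>d\<close> and \<open>c\<close>,
        while \<open>sup x d\<close> does lie between them; hence it is comparable with every chain
        point.\<close>
      have "sup x d \<in> C"
      proof (rule maximal)
        fix y assume y: "y \<in> C"
        show "y \<le> sup x d \<or> sup x d \<le> y"
        proof (cases "y < c")
          case True
          then have "y \<le> d"
            using chain[OF y d(1)] dmax[OF y] by auto
          then show ?thesis
            by (simp add: le_supI2)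
        next
          case False
          then have "c \<le> y"
            using chain[OF y less.prems(1)] by auto
          moreover have "sup x d \<le> c"
            using less.prems(2) d(2) by simp
          ultimately show ?thesis
            by auto
        qed
      qed
      then have sup_eq: "sup (f x) d = sup x d"
        using automorphism_sup[OF f, of x d] fixed[of "sup x d"] fixed[of d] d(1) by simp
      have "inf (f x) d = inf x d"
        using automorphism_inf[OF f, of x d] below_d[of d] below_d[of "inf x d"] by simp
      then show ?thesis
        using sup_eq by (rule distrib_lattice_cancel)
    qed
  qed
  \<comment> \<open>The top of the lattice is comparable with everything, and every point lies below
    it.\<close>
  have "Sup_fin UNIV \<in> C"
    by (intro maximal) (simp add: Sup_fin.coboundedI)
  then show ?thesis
    by (rule below) (simp add: Sup_fin.coboundedI)
qed

lemma distinguishing_number_distrib_lattice_le_2: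
  "distinguishing_number (UNIV :: 'a::{finite, distrib_lattice} set) \<le> 2"
proof -
  obtain C :: "'a set" where chain: "\<And>x y. x \<in> C \<Longrightarrow> y \<in> C \<Longrightarrow> x \<le> y \<or> y \<le> x"
    and maximal: "\<And>z. (\<And>x. x \<in> C \<Longrightarrow> x \<le> z \<or> z \<le> x) \<Longrightarrow> z \<in> C"
    using obtain_maximal_chain by blast
  define c :: "'a \<Rightarrow> nat" where "c x = of_bool (x \<in> C)" for x
  have "f x = x" if f: "poset_automorphism UNIV f" and "\<forall>x. c (f x) = c x" for f x
  proof (rule automorphism_fixing_maximal_chain[OF f chain maximal])
    fix x assume x: "x \<in> C"
    \<comment> \<open>Colours keep \<open>f x\<close> on the chain, where it is comparable with
      \<open>x\<close>.\<close>
    then have "f x \<in> C"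
      using that(2) by (metis c_def of_bool_eq_iff)
    with x show "f x = x"
      using chain automorphism_fixes_if_comparable[OF f] by blast
  qed
  then have "distinguishing UNIV c"
    by (simp add: distinguishing_def)
  then show ?thesis
    by (intro distinguishing_number_le[of c]) (auto simp: c_def of_bool_def)
qed

section \<open>Join-irreducible elements\<close>

lemma less_imp_le_lower_cover:
  fixes x y :: "'a::{finite, order}"
  assumes "x < y"
  obtains u where "x \<le> u" "covered_by u y"
proof -
  obtain u where u: "x \<le> u" "u < y" "\<And>v. v < y \<Longrightarrow> u \<le> v \<Longrightarrow> u = v"
    using finite_has_maximal2[of "{u. u < y}" x] assms by auto
  then have "covered_by u y"
    unfolding covered_by_def by (metis less_le)
  with u(1) show thesis
    by (rule that)
qed

text \<open>By finiteness every point strictly below \<open>j\<close> lies under some lower cover,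
  and there is only one.\<close>

lemma join_irreducible_obtain_lower_cover:
  fixes j :: "'a::{finite, lattice}"
  assumes "join_irreducible j"
  obtains u where "u < j" "\<And>x. x < j \<Longrightarrow> x \<le> u"
proof -
  obtain u where u: "covered_by u j" "\<And>v. covered_by v j \<Longrightarrow> v = u"
    using assms unfolding join_irreducible_def by blast
  have "x \<le> u" if "x < j" for x
    using less_imp_le_lower_cover[OF that] u(2) by metis
  with u(1) show thesis
    unfolding covered_by_def by (intro that[of u]) auto
qed

text \<open>Join-irreducibles are join-prime: by distributivity \<open>j\<close> is the join of
  \<open>inf j a\<close> and \<open>inf j b\<close>, and if both were strictly below
  \<open>j\<close>, their join would be at most its lower cover.\<close>

lemma join_irreducible_le_sup_iff:
  fixes j :: "'a::{finite, distrib_lattice}"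
  assumes "join_irreducible j"
  shows "j \<le> sup a b \<longleftrightarrow> j \<le> a \<or> j \<le> b"
proof
  obtain u where u: "u < j" "\<And>x. x < j \<Longrightarrow> x \<le> u"
    using join_irreducible_obtain_lower_cover[OF assms] by blast
  assume "j \<le> sup a b"
  then have j: "j = sup (inf j a) (inf j b)"
    by (metis inf.absorb1 inf_sup_distrib1)
  show "j \<le> a \<or> j \<le> b"
  proof (rule ccontr)
    assume "\<not> (j \<le> a \<or> j \<le> b)"
    then have "inf j a < j" "inf j b < j"
      by (metis inf.cobounded1 inf.cobounded2 order.order_iff_strict)+
    then have "sup (inf j a) (inf j b) \<le> u"
      using u(2) by simp
    with u(1) j show False
      by simp
  qed
qed (auto intro: le_supI1 le_supI2)

text \<open>A minimal \<open>z\<close> below \<open>x\<close> but not below \<open>y\<close> is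
  join-irreducible: two distinct lower covers would join to \<open>z\<close>, yet both are below
  \<open>y\<close>.\<close>

lemma le_if_join_irreducibles_le:
  fixes x y :: "'a::{finite, lattice}"
  assumes "\<And>j. join_irreducible j \<Longrightarrow> j \<le> x \<Longrightarrow> j \<le> y"
  shows "x \<le> y"
proof (rule ccontr)
  assume "\<not> x \<le> y"
  then obtain z where z: "z \<le> x" "\<not> z \<le> y"
    and zmin: "\<And>w. w \<le> x \<Longrightarrow> \<not> w \<le> y \<Longrightarrow> w \<le> z \<Longrightarrow> z = w"
    using finite_has_minimal[of "{z. z \<le> x \<and> \<not> z \<le> y}"] by auto
  have below: "w \<le> y" if "w < z" for w
    using zmin[of w] that z(1) by fastforce
  \<comment> \<open>This shows that \<open>z\<close> is not the bottom, so it has a lower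
    cover.\<close>
  have "inf z y < z"
    using z(2) by (metis inf.cobounded1 inf.cobounded2 order.order_iff_strict)
  then obtain u where u: "covered_by u z"
    using less_imp_le_lower_cover by blast
  have "v = u" if v: "covered_by v z" for v
  proof (rule ccontr)
    assume "v \<noteq> u"
    have "sup u v \<le> y"
      using below u v by (simp add: covered_by_def)
    then have "sup u v \<noteq> z"
      using z(2) by blast
    moreover have "sup u v \<le> z"
      using u v by (simp add: covered_by_def less_imp_le)
    ultimately have "sup u v < z"
      by (rule order.not_eq_order_implies_strict)
    then have "\<not> u < sup u v" "\<not> v < sup u v"
      using u v unfolding covered_by_def by blast+
    then have "sup u v = u" "sup u v = v"
      by (metis sup_ge1 order.order_iff_strict, metis sup_ge2 order.order_iff_strict)
    with \<open>v \<noteq> u\<close> show False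
      by simp
  qed
  with u have "join_irreducible z"
    unfolding join_irreducible_def by blast
  with assms z show False
    by blast
qed

lemma eq_if_same_join_irreducibles:
  fixes x y :: "'a::{finite, lattice}"
  assumes "\<And>j. join_irreducible j \<Longrightarrow> j \<le> x \<longleftrightarrow> j \<le> y"
  shows "x = y"
  by (rule antisym; rule le_if_join_irreducibles_le) (simp_all add: assms)

text \<open>The existence half of Birkhoff's representation: the witness is the join of
  \<open>D\<close>, and join-primeness makes the join-irreducibles below it exactly those below a
  member of \<open>D\<close>.\<close>

lemma ex_generated_by_join_irreducibles:
  fixes D :: "'a::{finite, distrib_lattice} set"
  shows "\<exists>y. \<forall>j. join_irreducible j \<longrightarrow> (j \<le> y \<longleftrightarrow> (\<exists>d\<in>D. j \<le> d))"
proof (induction D rule: finite_induct[OF finite])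
  case 1
  \<comment> \<open>The empty join is the bottom, written \<open>Inf_fin UNIV\<close>.\<close>
  have "\<not> j \<le> Inf_fin UNIV" if j: "join_irreducible j" for j :: 'a
  proof -
    obtain u where "u < j"
      using join_irreducible_obtain_lower_cover[OF j] .
    moreover have "Inf_fin UNIV \<le> u"
      by (simp add: Inf_fin.coboundedI)
    ultimately show ?thesis
      by auto
  qed
  then show ?case
    by auto
next
  case (2 d D)
  then obtain y where "\<forall>j. join_irreducible j \<longrightarrow> (j \<le> y \<longleftrightarrow> (\<exists>d\<in>D. j \<le> d))"
    by blast
  then have "\<forall>j. join_irreducible j \<longrightarrow> (j \<le> sup d y \<longleftrightarrow> (\<exists>d\<in>insert d D. j \<le> d))"
    by (simp add: join_irreducible_le_sup_iff)
  then show ?case ..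
qed

section \<open>Rigidity of the lattice and of its join-irreducibles\<close>

lemma automorphism_covered_by_iff:
  assumes f: "poset_automorphism (UNIV :: 'a::order set) f"
  shows "covered_by (f x) (f y) \<longleftrightarrow> covered_by x y"
proof -
  have "(\<exists>z. f x < z \<and> z < f y) \<longleftrightarrow> (\<exists>z. f x < f z \<and> f z < f y)"
    using f by (metis automorphism_UNIV_iff bij_pointE)
  then show ?thesis
    by (simp add: covered_by_def automorphism_less_iff[OF f])
qed

lemma automorphism_join_irreducible_iff:
  assumes f: "poset_automorphism (UNIV :: 'a::lattice set) f"
  shows "join_irreducible (f x) \<longleftrightarrow> join_irreducible x"
proof -
  have "bij f"
    using f by (simp add: automorphism_UNIV_iff)
  then have "bij_betw f {u. covered_by u x} {u. covered_by u (f x)}"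
    using automorphism_covered_by_iff[OF f, of _ x]
    by (auto simp: bij_betw_def inj_on_def image_iff) (metis surjD)
  then have "card {u. covered_by u (f x)} = card {u. covered_by u x}"
    by (simp add: bij_betw_same_card)
  \<comment> \<open>Counting lower covers reduces the claim to the bijection above.\<close>
  moreover have "join_irreducible y \<longleftrightarrow> card {u. covered_by u y} = Suc 0" for y :: 'a
    by (auto simp: join_irreducible_def card_1_singleton_iff set_eq_iff)
  ultimately show ?thesis
    by simp
qed

lemma rigid_if_rigid_join_irreducibles:
  assumes "rigid {x :: 'a::{finite, lattice}. join_irreducible x}"
  shows "rigid (UNIV :: 'a set)"
  unfolding rigid_def
proof (intro allI impI ballI)
  fix f :: "'a \<Rightarrow> 'a" and x
  assume f: "poset_automorphism UNIV f"
  let ?Q = "{x :: 'a. join_irreducible x}"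
  have "f ` ?Q = ?Q"
    using f automorphism_join_irreducible_iff[OF f]
    by (auto simp: image_iff) (metis automorphism_UNIV_iff bij_pointE)
  moreover have "inj_on f ?Q"
    using f by (meson automorphism_UNIV_iff bij_is_inj inj_on_subset subset_UNIV)
  ultimately have "poset_automorphism ?Q f"
    using f by (simp add: poset_automorphism_def bij_betw_def)
  then have fixed: "f j = j" if "join_irreducible j" for j
    using assms that by (simp add: rigid_def)
  show "f x = x"
  proof (rule eq_if_same_join_irreducibles)
    fix j :: 'a assume "join_irreducible j"
    then show "j \<le> f x \<longleftrightarrow> j \<le> x"
      using f fixed by (metis automorphism_UNIV_iff)
  qed
qed

text \<open>Transport along Birkhoff's representation: \<open>f x\<close> is the join of the images
  \<open>g i\<close> of the join-irreducibles \<open>i\<close> below \<open>x\<close>.\<close>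

lemma automorphism_join_irreducibles_extends:
  assumes g: "poset_automorphism {x :: 'a::{finite, distrib_lattice}. join_irreducible x} g"
  obtains f where "poset_automorphism UNIV f" "\<And>j. join_irreducible j \<Longrightarrow> f j = g j"
proof -
  have gQ: "join_irreducible (g j)" if "join_irreducible j" for j
    using g that by (auto simp: poset_automorphism_def dest: bij_betwE)
  have g_le: "g i \<le> g j \<longleftrightarrow> i \<le> j" if "join_irreducible i" "join_irreducible j" for i j
    using g that by (simp add: poset_automorphism_def)
  have g_surj: "\<exists>i. join_irreducible i \<and> j = g i" if "join_irreducible j" for j
    using g that unfolding poset_automorphism_def bij_betw_def by blast
  have "\<exists>y. \<forall>j. join_irreducible j \<longrightarrow> (j \<le> y \<longleftrightarrow> (\<exists>d \<in> g ` {i. join_irreducible i \<and> i \<le> x}. j \<le> d))"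
    for x by (rule ex_generated_by_join_irreducibles)
  then obtain f where f: "\<And>x j. join_irreducible j \<Longrightarrow>
      j \<le> f x \<longleftrightarrow> (\<exists>i. join_irreducible i \<and> i \<le> x \<and> j \<le> g i)"
    by (simp add: image_iff) metis
  \<comment> \<open>Thus \<open>f x\<close> determines which join-irreducibles lie below
    \<open>x\<close>, so \<open>f\<close> reflects the order.\<close>
  have f_le: "g j \<le> f x \<longleftrightarrow> j \<le> x" if "join_irreducible j" for j x
    using f[OF gQ[OF that]] g_le that by (metis order.trans order_refl)
  have mono: "x \<le> y \<longleftrightarrow> f x \<le> f y" for x y
  proof
    assume "x \<le> y"
    show "f x \<le> f y"
      by (rule le_if_join_irreducibles_le) (use \<open>x \<le> y\<close> in \<open>auto simp: f intro: order.trans\<close>)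
  next
    assume "f x \<le> f y"
    show "x \<le> y"
      by (rule le_if_join_irreducibles_le) (use \<open>f x \<le> f y\<close> f_le order.trans in blast)
  qed
  have "inj f"
    by (intro injI antisym) (simp_all add: mono[THEN iffD2])
  then have "bij f"
    by (simp add: bij_def finite_UNIV_inj_surj)
  with mono have "poset_automorphism UNIV f"
    by (simp add: automorphism_UNIV_iff)
  moreover have "f j = g j" if j: "join_irreducible j" for j
  proof (rule eq_if_same_join_irreducibles)
    fix k :: 'a assume "join_irreducible k"
    then obtain i where "join_irreducible i" "k = g i"
      using g_surj by blast
    then show "k \<le> f j \<longleftrightarrow> k \<le> g j"
      using f_le g_le j by simp
  qed
  ultimately show thesis
    by (rule that)
qed

lemma rigid_join_irreducibles_if_rigid:
  assumes "rigid (UNIV :: 'a::{finite, distrib_lattice} set)"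
  shows "rigid {x :: 'a. join_irreducible x}"
  unfolding rigid_def
proof (intro allI impI ballI)
  fix g :: "'a \<Rightarrow> 'a" and j :: 'a
  assume "poset_automorphism {x. join_irreducible x} g" and j: "j \<in> {x. join_irreducible x}"
  then obtain f where "poset_automorphism UNIV f" "\<And>j :: 'a. join_irreducible j \<Longrightarrow> f j = g j"
    using automorphism_join_irreducibles_extends by blast
  with assms j show "g j = j"
    by (metis UNIV_I mem_Collect_eq rigid_def)
qed

theorem theorem3p8:
  shows "distinguishing_number (UNIV :: 'a::{finite, distrib_lattice} set) \<le> 2 \<and>
    (distinguishing_number (UNIV :: 'a set) = 2 \<longleftrightarrow>
     distinguishing_number {x :: 'a. join_irreducible x} > 1)"
proof -
  \<comment> \<open>Given the bound 2, the value 2 means exactly that the number is not at most 1,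
    so comparing rigidity suffices.\<close>
  have "distinguishing_number (UNIV :: 'a set) \<le> 1 \<longleftrightarrow>
      distinguishing_number {x :: 'a. join_irreducible x} \<le> 1"
    unfolding distinguishing_number_le_1_iff[OF finite]
    using rigid_if_rigid_join_irreducibles rigid_join_irreducibles_if_rigid by blast
  with distinguishing_number_distrib_lattice_le_2[where 'a = 'a] show ?thesis
    by linarith
qed

end
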